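(* Let $$\Delta(t)=\left(t^{1/2}-t^{-1/2}\right)\left(a_0-a_1(t+t^{-1})+a_2(t^2+t^{-2})-\cdots+(-1)^n a_n(t^n+t^{-n})\right)$$ be the Alexander polynomial of a two-component two-bridge link. Then either all the coefficients $a_i$ are even, or there exists an integer $k\le n$ such that $a_k,a_{k-2},a_{k-4},\dots$ (all indices $\ge 0$) are odd and the other coefficients are even.
   Context: The Alexander polynomial of an oriented link $K$ is $\Delta_K(t)=\nabla_K(t^{1/2}-t^{-1/2})$ (possibly normalized by a sign), where $\nabla_K(z)\in\mathbf{Z}[z]$ is the Conway polynomial, defined by $\nabla_{\text{unknot}}=1$ and $\nabla_{L_+}-\nabla_{L_-}=z\nabla_{L_0}$. Two-bridge links: for nonzero integers $b_1,\dots,b_m$ ($m\ge 0$), $C(2b_1,-2b_2,\dots,(-1)^{m-1}2b_m)$ denotes the two-bridge link in Conway normal form with these numbers of signed crossings in its successive twist regions (its Schubert fraction is the continued fraction $[2b_1,-2b_2,\dots,(-1)^{m-1}2b_m]$, where $[a_1,\dots,a_n]=a_1+1/(a_2+1/(\cdots+1/a_n))$), oriented so that the two strands of each twist region are antiparallel. Every oriented two-bridge link is of this form; it has two components if and only if $m$ is odd. It is known (Siebenmann; Cromwell) that the Conway polynomial of $C(2b_1,-2b_2,\dots,(-1)^{m-1}2b_m)$ is the Euler continuant polynomial $D_m(b_1,\dots,b_m)(z)$ defined by $D_{-1}=0$, $D_0=1$, $D_k=b_k z D_{k-1}+D_{k-2}$. *)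

theory Defs
  imports "HOL-Computational_Algebra.Formal_Laurent_Series"
begin

text \<open>
  Oriented links are represented by oriented diagrams in Morse position, modulo Reidemeister moves.
  A diagram is cut by horizontal lines into elementary slices and is read from bottom to top.
  Between two slices there are finitely many strands, numbered from left to right starting with 0;
  their orientations are recorded in a list of Booleans, where True means upward.

  In all three constructors the first argument is the index of the leftmost strand involved.
  \<^item> Cup i b: a local minimum whose two legs become the strands i and i + 1; its left leg is
    oriented upward iff b.
  \<^item> Cap i: a local maximum joining the strands i and i + 1.
  \<^item> Cross i s: the strands i and i + 1 cross; s says that the strand running from the bottom
    left to the top right is the over-strand.
\<close>

datatype slice = Cup nat bool | Cap nat | Cross nat bool

type_synonym word = "slice list"

fun act :: "slice \<Rightarrow> bool list \<Rightarrow> bool list option" where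
  "act (Cup i b) e =
     (if i \<le> length e then Some (take i e @ [b, \<not> b] @ drop i e) else None)"
| "act (Cap i) e =
     (if Suc i < length e \<and> e ! i \<noteq> e ! Suc i then Some (take i e @ drop (i + 2) e) else None)"
| "act (Cross i s) e =
     (if Suc i < length e then Some (take i e @ [e ! Suc i, e ! i] @ drop (i + 2) e) else None)"

fun run :: "word \<Rightarrow> bool list \<Rightarrow> bool list option" where
  "run [] e = Some e"
| "run (x # w) e = Option.bind (act x e) (run w)"

definition link_diagram :: "word \<Rightarrow> bool" where
  "link_diagram D \<longleftrightarrow> run D [] = Some []"


subsection \<open>Isotopy\<close>

fun shift :: "nat \<Rightarrow> slice \<Rightarrow> slice" where
  "shift k (Cup i b) = Cup (k + i) b"
| "shift k (Cap i) = Cap (k + i)"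
| "shift k (Cross i s) = Cross (k + i) s"

fun position :: "slice \<Rightarrow> nat" where
  "position (Cup i b) = i"
| "position (Cap i) = i"
| "position (Cross i s) = i"

fun strands_in :: "slice \<Rightarrow> nat" where
  "strands_in (Cup i b) = 0"
| "strands_in (Cap i) = 2"
| "strands_in (Cross i s) = 2"

fun strands_out :: "slice \<Rightarrow> nat" where
  "strands_out (Cup i b) = 2"
| "strands_out (Cap i) = 0"
| "strands_out (Cross i s) = 2"

text \<open>
  The generating moves for oriented tangle diagrams in Morse position. The rules exchange,
  zigzag and slide (a strand passing over or under an extremum) include the planar isotopies;
  R1, R2, R3 are the Reidemeister moves. In exchange the slice y lies entirely to the right of x.
  The variants of R3 with other choices of over-strands follow from this one and R2.
\<close>

inductive move :: "word \<Rightarrow> word \<Rightarrow> bool" where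
  exchange: "position x \<le> position y \<Longrightarrow>
     move [x, shift (strands_out x) y] [shift (strands_in x) y, x]"
| zigzag_left: "move [Cup i b, Cap (Suc i)] []"
| zigzag_right: "move [Cup (Suc i) b, Cap i] []"
| slide_cup: "move [Cup (Suc i) b, Cross i s] [Cup i b, Cross (Suc i) (\<not> s)]"
| slide_cap: "move [Cross i s, Cap (Suc i)] [Cross (Suc i) (\<not> s), Cap i]"
| R1_cup: "move [Cup i b, Cross i s] [Cup i (\<not> b)]"
| R1_cap: "move [Cross i s, Cap i] [Cap i]"
| R2: "move [Cross i s, Cross i (\<not> s)] []"
| R3: "move [Cross i s, Cross (Suc i) s, Cross i s] [Cross (Suc i) s, Cross i s, Cross (Suc i) s]"

inductive diagram_move :: "word \<Rightarrow> word \<Rightarrow> bool" where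
  "move l r \<Longrightarrow> link_diagram (u @ l @ v) \<Longrightarrow> link_diagram (u @ r @ v) \<Longrightarrow>
     diagram_move (u @ l @ v) (u @ r @ v)"

definition isotopic :: "word \<Rightarrow> word \<Rightarrow> bool" where
  "isotopic = equivclp diagram_move"


subsection \<open>Components and bridge number\<close>

text \<open>
  The list argument labels the strands at the current level, two strands having the same label iff
  they are connected below that level. The label introduced at a Cup is fresh because the number
  of remaining slices decreases. A Cap joining two equally labelled strands closes a component.
\<close>

fun closed_components :: "word \<Rightarrow> nat list \<Rightarrow> nat" where
  "closed_components [] l = 0"
| "closed_components (Cup i b # w) l =
     closed_components w (take i l @ [length w, length w] @ drop i l)"
| "closed_components (Cap i # w) l =
     (let l' = take i l @ drop (i + 2) l in
      if l ! i = l ! Suc i then Suc (closed_components w l')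
      else closed_components w (map (\<lambda>x. if x = l ! i then l ! Suc i else x) l'))"
| "closed_components (Cross i s # w) l =
     closed_components w (take i l @ [l ! Suc i, l ! i] @ drop (i + 2) l)"

definition num_components :: "word \<Rightarrow> nat" where
  "num_components D = closed_components D []"

definition num_maxima :: "word \<Rightarrow> nat" where
  "num_maxima D = length (filter (\<lambda>x. \<exists>i. x = Cap i) D)"

definition bridge_number :: "word \<Rightarrow> nat" where
  "bridge_number D = (LEAST k. \<exists>D'. isotopic D D' \<and> num_maxima D' = k)"

definition two_bridge_link :: "word \<Rightarrow> bool" where
  "two_bridge_link D \<longleftrightarrow> link_diagram D \<and> bridge_number D = 2"


subsection \<open>Conway and Alexander polynomials\<close>

text \<open>
  The arguments are the diagrams with a positive crossing, with a negative crossing, and with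
  the oriented smoothing. If both strands point upward or both point downward, the crossing
  Cross i True is positive and its smoothing consists of two vertical strands. If they are
  antiparallel, the crossing Cross i False is positive and the smoothing is a maximum below a
  minimum.
\<close>

inductive skein_triple :: "word \<Rightarrow> word \<Rightarrow> word \<Rightarrow> bool" where
  parallel: "run u [] = Some e \<Longrightarrow> Suc i < length e \<Longrightarrow> e ! i = e ! Suc i \<Longrightarrow>
     link_diagram (u @ Cross i True # v) \<Longrightarrow>
     skein_triple (u @ Cross i True # v) (u @ Cross i False # v) (u @ v)"
| antiparallel: "run u [] = Some e \<Longrightarrow> Suc i < length e \<Longrightarrow> e ! i \<noteq> e ! Suc i \<Longrightarrow>
     link_diagram (u @ Cross i True # v) \<Longrightarrow>
     skein_triple (u @ Cross i False # v) (u @ Cross i True # v)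
       (u @ Cap i # Cup i (e ! Suc i) # v)"

text \<open>
  A function assigning to every oriented link its Conway polynomial, characterised by isotopy
  invariance, its value on the unknot and the skein relation; [:0, 1:] is the variable z. On
  diagrams of nonempty links these conditions determine the values.
\<close>

definition conway_polynomial :: "(word \<Rightarrow> int poly) \<Rightarrow> bool" where
  "conway_polynomial conway \<longleftrightarrow>
     (\<forall>D D'. link_diagram D \<longrightarrow> isotopic D D' \<longrightarrow> conway D = conway D') \<and>
     (\<forall>b. conway [Cup 0 b, Cap 0] = 1) \<and>
     (\<forall>Dp Dm D0. skein_triple Dp Dm D0 \<longrightarrow> conway Dp - conway Dm = [:0, 1:] * conway D0)"

text \<open>
  Laurent polynomials in the square root of t are elements of the ring of formal Laurent series in
  fls_X, which stands for the square root of t. The Alexander polynomial is taken up to sign.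
\<close>

definition is_alexander_polynomial :: "(word \<Rightarrow> int poly) \<Rightarrow> word \<Rightarrow> int fls \<Rightarrow> bool" where
  "is_alexander_polynomial conway D \<Delta> \<longleftrightarrow>
     (\<exists>\<epsilon>\<in>{1, -1}. \<Delta> = \<epsilon> * poly (map_poly of_int (conway D)) (fls_X - fls_X_inv))"

end

theory Submission
  imports Defs "HOL-Library.Z2"
begin

text \<open>
  The idea is that modulo 2 the Conway polynomial of a two-bridge link is a Fibonacci polynomial
  $F_n$, where $F_0 = 0$, $F_1 = 1$ and $F_{n+2} = z F_{n+1} + F_n$. In terms of the Euler
  continuants $D_k = b_k z D_{k-1} + D_{k-2}$ this is visible at once: modulo 2, an even $b_k$ swaps
  the pair $(D_k, D_{k-1})$, and an odd $b_k$ moves it one step forward or backward along the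
  Fibonacci sequence.

  The continued fraction expansion is bypassed by working directly with diagrams. A link with
  bridge number 2 has a diagram with two maxima and two minima, read from bottom to top. As soon as
  four strands are present, the part of the diagram below the current level is a tangle with four
  ends. Up to isotopy and the skein relation it is a combination of two out of three basic tangles:
  two minima side by side, two nested minima, and two minima side by side whose inner legs cross
  (the rational tangles of slope 0, infinity and $\pm 1$). The orientations of the four strands
  exclude exactly one of the three. Adding a crossing permutes the basic tangles, if the sign of the
  crossing in the third one is chosen suitably; changing that sign replaces the coefficient pair
  $(f, g)$ by $(f + z g, g)$. Hence the two coefficients always remain neighbours in the
  Fibonacci sequence (\<open>rational_tangle_Cross\<close>). A maximum turns one of the two basic tangles into
  a single arc and the other one into an arc with a split circle. The latter contributes 0, so a
  single Fibonacci polynomial survives (\<open>rational_tangle_Cap\<close>, \<open>nabla_two_bridge\<close>).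

  It remains to compare coefficients. With $z = x - x^{-1}$ and $x = t^{1/2}$, the Laurent
  polynomial $F_{j+1}$ is congruent modulo 2 to $x^j + x^{j-2} + \cdots + x^{-j}$
  (\<open>fib_poly_at_X_diff\<close>). As $\Delta$ is $x - x^{-1}$ times a Laurent polynomial in $x^2$, its exponents
  are odd, so $j = 2k + 1$ unless everything is even. Then $a_i + a_{i+1}$ is odd exactly for
  $i \le k$, where $a_{n+1} = 0$, and descending from large $i$ determines all parities.
\<close>

section \<open>Isotopy of tangles\<close>

lemma run_append: "run (u @ v) e = Option.bind (run u e) (run v)"
proof (induction u arbitrary: e)
  case (Cons x u)
  then show ?case by (cases "act x e") simp_all
qed simp

lemma link_diagram_cong: "run u [] = run u' [] \<Longrightarrow> link_diagram (u @ v) \<longleftrightarrow> link_diagram (u' @ v)"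
  by (simp add: link_diagram_def run_append)

text \<open>
  An initial part of a diagram is an oriented tangle whose ends are the strands at its last level.
  Isotopy is defined for closed diagrams only, so tangles are compared through all their
  completions above that level.
\<close>

definition tangle_isotopic :: "word \<Rightarrow> word \<Rightarrow> bool" (infix "\<simeq>" 50) where
  "u \<simeq> u' \<longleftrightarrow> run u [] = run u' [] \<and> (\<forall>v. link_diagram (u @ v) \<longrightarrow> isotopic (u @ v) (u' @ v))"

lemma isotopic_refl: "isotopic D D"
  by (simp add: isotopic_def)

lemma tangle_isotopic_sym: "u \<simeq> u' \<Longrightarrow> u' \<simeq> u"
  by (auto simp: tangle_isotopic_def isotopic_def link_diagram_def run_append intro: equivclp_sym)

lemma tangle_isotopic_trans [trans]: "u \<simeq> u' \<Longrightarrow> u' \<simeq> u'' \<Longrightarrow> u \<simeq> u''"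
  unfolding tangle_isotopic_def isotopic_def link_diagram_def run_append
  by (metis equivclp_trans)

lemma tangle_isotopic_append: "u \<simeq> u' \<Longrightarrow> u @ w \<simeq> u' @ w"
  by (auto simp: tangle_isotopic_def run_append)

lemma tangle_isotopic_move:
  assumes "move l r" and "run (p @ l) [] = run (p @ r) []"
  shows "p @ l @ q \<simeq> p @ r @ q"
  unfolding tangle_isotopic_def
proof (intro conjI allI impI)
  show eq: "run (p @ l @ q) [] = run (p @ r @ q) []"
    using assms(2) run_append[of "p @ l" q "[]"] run_append[of "p @ r" q "[]"] by simp
  fix v
  assume "link_diagram ((p @ l @ q) @ v)"
  moreover from this have "link_diagram ((p @ r @ q) @ v)"
    using eq unfolding link_diagram_def run_append[of _ v] by simp
  ultimately have "diagram_move (p @ l @ q @ v) (p @ r @ q @ v)"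
    using diagram_move.intros[OF assms(1), of p "q @ v"] by simp
  then show "isotopic ((p @ l @ q) @ v) ((p @ r @ q) @ v)"
    by (auto simp: isotopic_def)
qed

lemma isotopic_link_diagram:
  assumes "isotopic D D'" and "link_diagram D"
  shows "link_diagram D'"
  using assms unfolding isotopic_def
  by (induction rule: equivclp_induct) (auto elim: diagram_move.cases)

section \<open>Tangles with two minima\<close>

text \<open>
  The rational tangles of slope 0, infinity and $\pm 1$ with arbitrarily oriented arcs. Each
  orientation of the four ends with two strands upward is realised by exactly two of the three.
\<close>

definition parallel_cups :: "bool \<Rightarrow> bool \<Rightarrow> word" where
  "parallel_cups b c = [Cup 0 b, Cup 2 c]"

definition nested_cups :: "bool \<Rightarrow> bool \<Rightarrow> word" where
  "nested_cups b c = [Cup 0 b, Cup (Suc 0) c]"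

definition crossed_cups :: "bool \<Rightarrow> bool \<Rightarrow> bool \<Rightarrow> word" where
  "crossed_cups b c s = [Cup 0 b, Cup 2 c, Cross (Suc 0) s]"

lemmas cups_defs = parallel_cups_def nested_cups_def crossed_cups_def

lemma run_cups [simp]:
  "run (parallel_cups b c) [] = Some [b, \<not> b, c, \<not> c]"
  "run (nested_cups b c) [] = Some [b, c, \<not> c, \<not> b]"
  "run (crossed_cups b c s) [] = Some [b, c, \<not> b, \<not> c]"
  by (simp_all add: cups_defs)

text \<open>
  On side-by-side minima an outer crossing is a kink, which only reverses the orientation of the
  arc below it. The middle crossing gives the third basic tangle.
\<close>

lemma parallel_cups_Cross:
  "parallel_cups b c @ [Cross 0 s] \<simeq> parallel_cups (\<not> b) c"
  "parallel_cups b c @ [Cross (Suc 0) s] \<simeq> crossed_cups b c s"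
  "parallel_cups b c @ [Cross 2 s] \<simeq> parallel_cups b (\<not> c)"
proof -
  have "parallel_cups b c @ [Cross 0 s] \<simeq> [Cup 0 b, Cross 0 s, Cup 2 c]"
    using tangle_isotopic_move[OF move.exchange[of "Cross 0 s" "Cup 0 c"], of "[Cup 0 b]" "[]"]
    by (simp add: cups_defs tangle_isotopic_sym)
  also have "\<dots> \<simeq> parallel_cups (\<not> b) c"
    using tangle_isotopic_move[OF move.R1_cup[of 0 b s], of "[]" "[Cup 2 c]"]
    by (simp add: cups_defs)
  finally show "parallel_cups b c @ [Cross 0 s] \<simeq> parallel_cups (\<not> b) c" .
  show "parallel_cups b c @ [Cross (Suc 0) s] \<simeq> crossed_cups b c s"
    by (simp add: cups_defs tangle_isotopic_def isotopic_refl)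
  show "parallel_cups b c @ [Cross 2 s] \<simeq> parallel_cups b (\<not> c)"
    using tangle_isotopic_move[OF move.R1_cup[of 2 c s], of "[Cup 0 b]" "[]"]
    by (simp add: cups_defs)
qed

lemma parallel_cups_commute: "[Cup 0 c, Cup 0 b] \<simeq> parallel_cups b c"
  using tangle_isotopic_move[OF move.exchange[of "Cup 0 b" "Cup 0 c"], of "[]" "[]"]
  by (simp add: cups_defs tangle_isotopic_sym)

text \<open>
  For nested minima the roles are exchanged. The middle crossing is a kink; at an outer crossing
  the leg of the outer arc is slid past the inner minimum, which places the two minima side by
  side and moves the crossing to the middle.
\<close>

lemma nested_cups_Cross:
  "nested_cups b c @ [Cross 0 s] \<simeq> crossed_cups c b (\<not> s)"
  "nested_cups b c @ [Cross (Suc 0) s] \<simeq> nested_cups b (\<not> c)"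
  "nested_cups b c @ [Cross 2 s] \<simeq> crossed_cups b c (\<not> s)"
proof -
  have "nested_cups b c @ [Cross 0 s] \<simeq> [Cup 0 b, Cup 0 c] @ [Cross (Suc 0) (\<not> s)]"
    using tangle_isotopic_move[OF move.slide_cup[of 0 c s], of "[Cup 0 b]" "[]"]
    by (simp add: cups_defs)
  also have "\<dots> \<simeq> crossed_cups c b (\<not> s)"
    using tangle_isotopic_append[OF parallel_cups_commute] by (simp add: cups_defs)
  finally show "nested_cups b c @ [Cross 0 s] \<simeq> crossed_cups c b (\<not> s)" .
  show "nested_cups b c @ [Cross (Suc 0) s] \<simeq> nested_cups b (\<not> c)"
    using tangle_isotopic_move[OF move.R1_cup[of "Suc 0" c s], of "[Cup 0 b]" "[]"]
    by (simp add: cups_defs)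
  show "nested_cups b c @ [Cross 2 s] \<simeq> crossed_cups b c (\<not> s)"
    using tangle_isotopic_move[OF move.slide_cup[of "Suc 0" c "\<not> s"], of "[Cup 0 b]" "[]"]
    by (simp add: cups_defs tangle_isotopic_sym numeral_2_eq_2)
qed

lemma tangle_isotopic_R2:
  assumes "run u [] = Some e" and "Suc i < length e"
  shows "u @ [Cross i s, Cross i (\<not> s)] \<simeq> u"
proof -
  have "take i (take i e @ [e ! Suc i, e ! i] @ drop (i + 2) e) = take i e"
    using assms by simp
  moreover have "drop (i + 2) (take i e @ [e ! Suc i, e ! i] @ drop (i + 2) e) = drop (i + 2) e"
    using assms by simp
  moreover have "take i e @ [e ! i, e ! Suc i] @ drop (i + 2) e = e"
    using assms by (simp add: Cons_nth_drop_Suc id_take_nth_drop[symmetric])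
  ultimately show ?thesis
    using tangle_isotopic_move[OF move.R2[of i s], of u "[]"] assms
    by (simp add: run_append nth_append)
qed

text \<open>
  By \<open>nested_cups_Cross\<close> the crossing of \<open>crossed_cups\<close> can be moved to any of the three
  positions, with the opposite over-strand in the outer ones. A new crossing at any position
  therefore cancels it, provided the over-strands fit.
\<close>

lemma crossed_cups_Cross:
  "crossed_cups b c s @ [Cross 0 s] \<simeq> nested_cups c b"
  "crossed_cups b c (\<not> s) @ [Cross (Suc 0) s] \<simeq> parallel_cups b c"
  "crossed_cups b c s @ [Cross 2 s] \<simeq> nested_cups b c"
proof -
  have "crossed_cups b c s @ [Cross 0 s] \<simeq> nested_cups c b @ [Cross 0 (\<not> s), Cross 0 s]"
    using tangle_isotopic_append[OF nested_cups_Cross(1)[of c b "\<not> s"], of "[Cross 0 s]"]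
    by (simp add: tangle_isotopic_sym)
  also have "\<dots> \<simeq> nested_cups c b"
    using tangle_isotopic_R2[of "nested_cups c b" _ 0 "\<not> s"] by simp
  finally show "crossed_cups b c s @ [Cross 0 s] \<simeq> nested_cups c b" .
  show "crossed_cups b c (\<not> s) @ [Cross (Suc 0) s] \<simeq> parallel_cups b c"
    using tangle_isotopic_R2[of "parallel_cups b c" _ "Suc 0" "\<not> s"] by (simp add: cups_defs)
  have "crossed_cups b c s @ [Cross 2 s] \<simeq> nested_cups b c @ [Cross 2 (\<not> s), Cross 2 s]"
    using tangle_isotopic_append[OF nested_cups_Cross(3)[of b c "\<not> s"], of "[Cross 2 s]"]
    by (simp add: tangle_isotopic_sym)
  also have "\<dots> \<simeq> nested_cups b c"
    using tangle_isotopic_R2[of "nested_cups b c" _ 2 "\<not> s"] by simp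
  finally show "crossed_cups b c s @ [Cross 2 s] \<simeq> nested_cups b c" .
qed

text \<open>
  The next lemmas close a basic tangle by a maximum that joins its two arcs; a crossing directly
  below the maximum is a kink.
\<close>

lemma nested_cups_Cap:
  "nested_cups b (\<not> b) @ [Cap 0] \<simeq> [Cup 0 b]"
  "nested_cups b (\<not> b) @ [Cap 2] \<simeq> [Cup 0 b]"
  using tangle_isotopic_move[OF move.zigzag_right[of 0 "\<not> b"], of "[Cup 0 b]" "[]"]
    tangle_isotopic_move[OF move.zigzag_left[of "Suc 0" "\<not> b"], of "[Cup 0 b]" "[]"]
  by (simp_all add: cups_defs numeral_2_eq_2)

lemma parallel_cups_Cap: "parallel_cups b b @ [Cap (Suc 0)] \<simeq> [Cup 0 b]"
  using tangle_isotopic_move[OF move.zigzag_right[of "Suc 0" b], of "[Cup 0 b]" "[]"]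
  by (simp add: cups_defs numeral_2_eq_2)

lemma tangle_isotopic_R1_cap:
  assumes "run u [] = Some e" and "Suc i < length e" and "e ! i \<noteq> e ! Suc i"
  shows "u @ [Cross i s, Cap i] \<simeq> u @ [Cap i]"
  using tangle_isotopic_move[OF move.R1_cap[of i s], of u "[]"] assms
  by (simp add: run_append nth_append)

lemma crossed_cups_Cap:
  "crossed_cups b b s @ [Cap (Suc 0)] \<simeq> [Cup 0 b]"
  "crossed_cups b (\<not> b) s @ [Cap 0] \<simeq> [Cup 0 (\<not> b)]"
  "crossed_cups b (\<not> b) s @ [Cap 2] \<simeq> [Cup 0 b]"
proof -
  have "crossed_cups b b s @ [Cap (Suc 0)] \<simeq> parallel_cups b b @ [Cap (Suc 0)]"
    using tangle_isotopic_R1_cap[of "parallel_cups b b" _ "Suc 0" s] by (simp add: cups_defs)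
  also note parallel_cups_Cap
  finally show "crossed_cups b b s @ [Cap (Suc 0)] \<simeq> [Cup 0 b]" .
  have "crossed_cups b (\<not> b) s @ [Cap 0] \<simeq> nested_cups (\<not> b) b @ [Cross 0 (\<not> s), Cap 0]"
    using tangle_isotopic_append[OF nested_cups_Cross(1)[of "\<not> b" b "\<not> s"], of "[Cap 0]"]
    by (simp add: tangle_isotopic_sym)
  also have "\<dots> \<simeq> nested_cups (\<not> b) b @ [Cap 0]"
    using tangle_isotopic_R1_cap[of "nested_cups (\<not> b) b" _ 0] by simp
  also have "\<dots> \<simeq> [Cup 0 (\<not> b)]"
    using nested_cups_Cap(1)[of "\<not> b"] by simp
  finally show "crossed_cups b (\<not> b) s @ [Cap 0] \<simeq> [Cup 0 (\<not> b)]" .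
  have "crossed_cups b (\<not> b) s @ [Cap 2] \<simeq> nested_cups b (\<not> b) @ [Cross 2 (\<not> s), Cap 2]"
    using tangle_isotopic_append[OF nested_cups_Cross(3)[of b "\<not> b" "\<not> s"], of "[Cap 2]"]
    by (simp add: tangle_isotopic_sym)
  also have "\<dots> \<simeq> nested_cups b (\<not> b) @ [Cap 2]"
    using tangle_isotopic_R1_cap[of "nested_cups b (\<not> b)" _ 2] by simp
  also note nested_cups_Cap(2)
  finally show "crossed_cups b (\<not> b) s @ [Cap 2] \<simeq> [Cup 0 b]" .
qed


section \<open>Fibonacci polynomials modulo 2\<close>

lemma bit_poly_add_self [simp]: "(p :: bit poly) + p = 0"
  by (rule poly_eqI) (simp only: coeff_add coeff_0, simp)

lemma bit_poly_add_left_cancel [simp]: "(p :: bit poly) + (p + q) = q"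
  by (simp flip: add.assoc)

lemma bit_poly_eq_add_iff: "(p :: bit poly) + q = r \<longleftrightarrow> p = r + q"
  by (metis add.assoc add.right_neutral bit_poly_add_self)

fun fib_poly :: "nat \<Rightarrow> 'a::comm_ring_1 poly" where
  "fib_poly 0 = 0"
| "fib_poly (Suc 0) = 1"
| "fib_poly (Suc (Suc n)) = [:0, 1:] * fib_poly (Suc n) + fib_poly n"

text \<open>
  Both orders are allowed because a new crossing may exchange the two basic tangles that the
  coefficients belong to.
\<close>

definition fib_pair :: "bit poly \<Rightarrow> bit poly \<Rightarrow> bool" where
  "fib_pair f g \<longleftrightarrow> (\<exists>n. {f, g} = {fib_poly n, fib_poly (Suc n)})"

lemma fib_pair_swap: "fib_pair f g \<Longrightarrow> fib_pair g f"
  by (simp add: fib_pair_def insert_commute)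

lemma fib_pair_0_1: "fib_pair 0 1"
  unfolding fib_pair_def by (rule exI[of _ 0]) simp

text \<open>
  Over a ring of characteristic 2 the Fibonacci recursion runs the same way in both directions, so
  adding $z g$ to $f$ steps over $g$ to its other neighbour. At the lower end of the sequence the
  pair $(1, 0)$ is fixed.
\<close>

lemma fib_pair_add:
  assumes "fib_pair f g"
  shows "fib_pair (f + [:0, 1:] * g) g"
proof -
  obtain n where "{f, g} = {fib_poly n, fib_poly (Suc n)}"
    using assms by (auto simp: fib_pair_def)
  then consider "f = fib_poly n" "g = fib_poly (Suc n)" | "f = fib_poly (Suc n)" "g = fib_poly n"
    by (auto simp: doubleton_eq_iff)
  then show ?thesis
  proof cases
    case 1
    then have "f + [:0, 1:] * g = fib_poly (Suc (Suc n))"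
      by (simp add: add.commute)
    then have "{f + [:0, 1:] * g, g} = {fib_poly (Suc n), fib_poly (Suc (Suc n))}"
      using 1(2) by (simp only: insert_commute)
    then show ?thesis unfolding fib_pair_def by (rule exI)
  next
    case 2
    show ?thesis
    proof (cases n)
      case 0
      then show ?thesis using 2 fib_pair_swap[OF fib_pair_0_1] by simp
    next
      case (Suc m)
      have "f = [:0, 1:] * g + fib_poly m"
        using 2 Suc by (simp only: fib_poly.simps)
      then have "f + [:0, 1:] * g = fib_poly m"
        by (metis add.commute bit_poly_add_left_cancel)
      then have "{f + [:0, 1:] * g, g} = {fib_poly m, fib_poly (Suc m)}"
        using 2 Suc by (simp only:)
      then show ?thesis unfolding fib_pair_def by (rule exI)
    qed
  qed
qed

section \<open>The Conway polynomial modulo 2\<close>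

locale conway_mod_two =
  fixes conway :: "word \<Rightarrow> int poly"
  assumes conway: "conway_polynomial conway"
begin

definition nabla :: "word \<Rightarrow> bit poly" where
  "nabla D = map_poly of_int (conway D)"

lemma nabla_isotopic: "isotopic D D' \<Longrightarrow> link_diagram D \<Longrightarrow> nabla D = nabla D'"
  using conway unfolding conway_polynomial_def nabla_def by metis

lemma nabla_tangle_isotopic: "u \<simeq> u' \<Longrightarrow> link_diagram (u @ v) \<Longrightarrow> nabla (u @ v) = nabla (u' @ v)"
  using nabla_isotopic by (auto simp: tangle_isotopic_def)

lemma nabla_unknot: "nabla [Cup 0 b, Cap 0] = 1"
  using conway by (simp add: conway_polynomial_def nabla_def)

lemma nabla_skein_triple:
  assumes "skein_triple Dp Dm D0"
  shows "nabla Dp + nabla Dm = [:0, 1:] * nabla D0"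
proof -
  have "conway Dp = conway Dm + [:0, 1:] * conway D0"
    using conway assms unfolding conway_polynomial_def by (metis diff_eq_eq add.commute)
  moreover have "map_poly of_int (p + [:0, 1:] * q) =
      map_poly of_int p + [:0, 1:] * (map_poly of_int q :: bit poly)" for p q
    by (rule poly_eqI) (simp add: coeff_map_poly coeff_pCons split: nat.split)
  ultimately show ?thesis
    by (simp add: nabla_def add_ac)
qed

text \<open>
  Modulo 2 the signs of crossings are immaterial, so the skein relation becomes symmetric and only
  the smoothing depends on the orientations.
\<close>

lemma nabla_skein:
  assumes "run u [] = Some e" and "Suc i < length e" and "link_diagram (u @ Cross i s # v)"
  shows "nabla (u @ Cross i s # v) + nabla (u @ Cross i (\<not> s) # v) =
    [:0, 1:] * (if e ! i = e ! Suc i then nabla (u @ v) else nabla (u @ Cap i # Cup i (e ! Suc i) # v))"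
proof -
  have "link_diagram (u @ Cross i True # v)"
    using assms by (simp add: link_diagram_def run_append)
  then have "nabla (u @ Cross i True # v) + nabla (u @ Cross i False # v) =
    [:0, 1:] * (if e ! i = e ! Suc i then nabla (u @ v) else nabla (u @ Cap i # Cup i (e ! Suc i) # v))"
    using nabla_skein_triple[OF skein_triple.parallel[OF assms(1,2)]]
      nabla_skein_triple[OF skein_triple.antiparallel[OF assms(1,2)]]
    by (simp add: add.commute)
  then show ?thesis
    by (cases s) (simp_all add: add.commute)
qed

text \<open>
  A strand with a positive kink and the same strand with a negative kink are isotopic, and
  smoothing the kink splits off a circle. Thus $z$ times the polynomial with the circle is a sum of
  two equal terms, which vanishes modulo 2, and $z$ can be cancelled.
\<close>

lemma nabla_split_circle:
  assumes "run p [] = Some e" and "i < length e" and "link_diagram (p @ v)"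
  shows "nabla (p @ Cup (Suc i) c # Cap (Suc i) # v) = 0"
proof -
  obtain x d y where e: "e = x @ d # y" "i = length x"
    using assms(2) id_take_nth_drop[of i e] by (metis length_take min.absorb2 less_imp_le)
  have p: "run (p @ w) [] = run w (x @ d # y)" for w
    using assms(1) e by (simp add: run_append)
  \<comment> \<open>The kink lies on strand \<open>i\<close>; the left leg of its minimum runs parallel to that strand.\<close>
  have curl: "p @ [Cup (Suc i) d, Cross i s, Cap (Suc i)] \<simeq> p" for s
  proof -
    have "p @ [Cup (Suc i) d, Cross i s, Cap (Suc i)]
        \<simeq> p @ [Cup i d, Cross (Suc i) (\<not> s), Cap (Suc i)]"
      using tangle_isotopic_move[OF move.slide_cup[of i d s], of p "[Cap (Suc i)]"]
      by (simp add: p e nth_append)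
    also have "\<dots> \<simeq> p @ [Cup i d, Cap (Suc i)]"
      using tangle_isotopic_R1_cap[of "p @ [Cup i d]" "x @ d # (\<not> d) # d # y" "Suc i"]
      by (simp add: p e nth_append)
    also have "\<dots> \<simeq> p"
      using tangle_isotopic_move[OF move.zigzag_left[of i d], of p "[]"] assms(1)
      by (simp add: p e nth_append)
    finally show ?thesis .
  qed
  have "[:0, 1:] * nabla (p @ Cup (Suc i) d # Cap (Suc i) # v) =
      nabla ((p @ [Cup (Suc i) d, Cross i True, Cap (Suc i)]) @ v) +
      nabla ((p @ [Cup (Suc i) d, Cross i False, Cap (Suc i)]) @ v)"
    using nabla_skein[of "p @ [Cup (Suc i) d]" "x @ d # d # (\<not> d) # y" i True "Cap (Suc i) # v"] assms(3)
    by (simp add: p e nth_append link_diagram_def)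
  also have "\<dots> = nabla (p @ v) + nabla (p @ v)"
    using nabla_tangle_isotopic[OF tangle_isotopic_sym[OF curl] assms(3)] by simp
  finally have d: "nabla (p @ Cup (Suc i) d # Cap (Suc i) # v) = 0"
    by simp
  \<comment> \<open>A circle with the opposite orientation differs from the previous one by a kink.\<close>
  have "p @ [Cup (Suc i) (\<not> d), Cap (Suc i)] \<simeq> p @ [Cup (Suc i) d, Cross (Suc i) True, Cap (Suc i)]"
    using tangle_isotopic_sym[OF tangle_isotopic_move[OF move.R1_cup[of "Suc i" d True], of p "[Cap (Suc i)]"]]
    by (simp add: p e nth_append)
  also have "\<dots> \<simeq> p @ [Cup (Suc i) d, Cap (Suc i)]"
    using tangle_isotopic_R1_cap[of "p @ [Cup (Suc i) d]" "x @ d # d # (\<not> d) # y" "Suc i"]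
    by (simp add: p e nth_append)
  finally have "nabla (p @ Cup (Suc i) (\<not> d) # Cap (Suc i) # v) = 0"
    using d nabla_tangle_isotopic[of "p @ [Cup (Suc i) (\<not> d), Cap (Suc i)]" "p @ [Cup (Suc i) d, Cap (Suc i)]" v]
      assms(3) by (simp add: p e link_diagram_def nth_append)
  with d show ?thesis
    by (cases "c = d") auto
qed

definition null :: "word \<Rightarrow> bool" where
  "null u \<longleftrightarrow> (\<forall>v. link_diagram (u @ v) \<longrightarrow> nabla (u @ v) = 0)"

lemma null_tangle_isotopic: "u \<simeq> u' \<Longrightarrow> null u' \<Longrightarrow> null u"
  unfolding null_def tangle_isotopic_def
  using nabla_isotopic isotopic_link_diagram by metis

text \<open>
  A maximum on both legs of one minimum splits off a circle. The general lemma has the circle to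
  the right of a strand; a circle on the left is first carried over the remaining arc by planar
  isotopies.
\<close>

lemma null_cups_Cap:
  "null (nested_cups b c @ [Cap (Suc 0)])"
  "null (parallel_cups b c @ [Cap 2])"
  "null (parallel_cups b c @ [Cap 0])"
proof -
  show 1: "null (nested_cups b c @ [Cap (Suc 0)])" for b c
    using nabla_split_circle[of "[Cup 0 b]" "[b, \<not> b]" 0]
    by (auto simp: null_def cups_defs link_diagram_def split: if_splits)
  show 2: "null (parallel_cups b c @ [Cap 2])" for b c
    using nabla_split_circle[of "[Cup 0 b]" "[b, \<not> b]" 1]
    by (auto simp: null_def cups_defs link_diagram_def numeral_2_eq_2 split: if_splits)
  have "parallel_cups b c @ [Cap 0] \<simeq> [Cup 0 b, Cap 0, Cup 0 c]"
    using tangle_isotopic_move[OF move.exchange[of "Cap 0" "Cup 0 c"], of "[Cup 0 b]" "[]"]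
    by (simp add: cups_defs tangle_isotopic_sym)
  also have "\<dots> \<simeq> [Cup 0 b, Cup 0 c, Cap 2]"
    using tangle_isotopic_move[OF move.exchange[of "Cup 0 c" "Cap 0"], of "[Cup 0 b]" "[]"]
    by (simp add: cups_defs tangle_isotopic_sym)
  also have "\<dots> \<simeq> parallel_cups c b @ [Cap 2]"
    using tangle_isotopic_append[OF parallel_cups_commute, of b c "[Cap 2]"] by simp
  finally show "null (parallel_cups b c @ [Cap 0])"
    using 2 null_tangle_isotopic by blast
qed

text \<open>
  Equality in the skein module modulo 2: the polynomials agree for every completion of the tangles.
\<close>

definition combination :: "word \<Rightarrow> bit poly \<Rightarrow> word \<Rightarrow> bit poly \<Rightarrow> word \<Rightarrow> bool" where
  "combination u f U g V \<longleftrightarrow> run u [] = run U [] \<and> run u [] = run V [] \<and>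
     (\<forall>v. link_diagram (u @ v) \<longrightarrow> nabla (u @ v) = f * nabla (U @ v) + g * nabla (V @ v))"

lemma combination_run:
  assumes "combination u f U g V"
  shows "run u [] = run U []" and "run u [] = run V []"
  using assms unfolding combination_def by blast+

lemma combination_swap: "combination u f U g V \<Longrightarrow> combination u g V f U"
  unfolding combination_def by (metis add.commute)

lemma combination_append:
  assumes "combination u f U g V" and "U @ w \<simeq> U'" and "V @ w \<simeq> V'"
  shows "combination (u @ w) f U' g V'"
  unfolding combination_def
proof (intro conjI allI impI)
  note run = combination_run[OF assms(1)]
  then show "run (u @ w) [] = run U' []" "run (u @ w) [] = run V' []"
    using assms(2,3) by (simp_all add: tangle_isotopic_def run_append)
  fix v
  assume v: "link_diagram ((u @ w) @ v)"
  then have "link_diagram ((U @ w) @ v)" "link_diagram ((V @ w) @ v)"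
    using link_diagram_cong[OF run(1), of "w @ v"] link_diagram_cong[OF run(2), of "w @ v"]
    by auto
  then have "nabla (U @ w @ v) = nabla (U' @ v)" "nabla (V @ w @ v) = nabla (V' @ v)"
    using nabla_tangle_isotopic[OF assms(2)] nabla_tangle_isotopic[OF assms(3)] by auto
  moreover have "nabla (u @ w @ v) = f * nabla (U @ w @ v) + g * nabla (V @ w @ v)"
    using v assms(1) unfolding combination_def append_assoc by blast
  ultimately show "nabla ((u @ w) @ v) = f * nabla (U' @ v) + g * nabla (V' @ v)"
    by (simp only: append_assoc)
qed

text \<open>
  The smoothing of the middle crossing depends on the orientations. If the inner legs are parallel,
  it removes the crossing; if they are antiparallel, a maximum and a minimum appear, which turn the
  side-by-side arcs into nested ones. In both cases the result is the other basic tangle whose ends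
  are oriented in the same way.
\<close>

lemma nabla_crossed_cups:
  assumes "link_diagram (crossed_cups b c s @ v)"
  shows "nabla (crossed_cups b c s @ v) + nabla (crossed_cups b c (\<not> s) @ v) =
    [:0, 1:] * nabla ((if b = c then nested_cups b c else parallel_cups b c) @ v)"
proof (cases "b = c")
  case True
  have "parallel_cups b b @ [Cap (Suc 0), Cup (Suc 0) b] \<simeq> nested_cups b b"
    using tangle_isotopic_append[OF parallel_cups_Cap, of b "[Cup (Suc 0) b]"]
    by (simp add: cups_defs)
  then show ?thesis
    using nabla_skein[of "parallel_cups b c" _ "Suc 0" s v] assms True
      nabla_tangle_isotopic[of "parallel_cups b b @ [Cap (Suc 0), Cup (Suc 0) b]" "nested_cups b b" v]
    by (simp add: cups_defs link_diagram_def numeral_2_eq_2)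
next
  case False
  then show ?thesis
    using nabla_skein[of "parallel_cups b c" _ "Suc 0" s v] assms
    by (simp add: cups_defs)
qed

lemma combination_crossing_change:
  assumes "combination u f (if b = c then nested_cups b c else parallel_cups b c) g (crossed_cups b c s)"
    (is "combination u f ?U g _")
  shows "combination u (f + [:0, 1:] * g) ?U g (crossed_cups b c (\<not> s))"
  unfolding combination_def
proof (intro conjI allI impI)
  show "run u [] = run ?U []" "run u [] = run (crossed_cups b c (\<not> s)) []"
    using assms by (simp_all add: combination_def)
  fix v
  assume v: "link_diagram (u @ v)"
  then have "link_diagram (crossed_cups b c s @ v)"
    using assms link_diagram_cong[of u "crossed_cups b c s" v] v by (simp add: combination_def)
  from nabla_crossed_cups[OF this]
  have skein: "nabla (crossed_cups b c s @ v) = [:0, 1:] * nabla (?U @ v) + nabla (crossed_cups b c (\<not> s) @ v)"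
    by (simp only: flip: bit_poly_eq_add_iff)
  have "nabla (u @ v) = f * nabla (?U @ v) + g * nabla (crossed_cups b c s @ v)"
    using assms v unfolding combination_def by blast
  also have "\<dots> = (f + [:0, 1:] * g) * nabla (?U @ v) + g * nabla (crossed_cups b c (\<not> s) @ v)"
    unfolding skein by (simp only: algebra_simps)
  finally show "nabla (u @ v) = (f + [:0, 1:] * g) * nabla (?U @ v) + g * nabla (crossed_cups b c (\<not> s) @ v)" .
qed

section \<open>Rational tangles\<close>

text \<open>
  The two rules list the pairs of basic tangles with equally oriented ends. The second one covers
  two cases, since \<open>crossed_cups b c s\<close> has the ends of \<open>nested_cups b b\<close> if
  \<open>b\<close> and \<open>c\<close> agree, and those of \<open>parallel_cups b c\<close> otherwise.
\<close>

inductive rational_tangle :: "word \<Rightarrow> bool" where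
  parallel_nested: "fib_pair f g \<Longrightarrow> combination u f (parallel_cups b b) g (nested_cups b (\<not> b))
    \<Longrightarrow> rational_tangle u"
| crossed: "fib_pair f g \<Longrightarrow>
    combination u f (if b = c then nested_cups b c else parallel_cups b c) g (crossed_cups b c s)
    \<Longrightarrow> rational_tangle u"

lemma rational_tangle_parallel_crossed:
  "fib_pair f g \<Longrightarrow> combination u f (parallel_cups b (\<not> b)) g (crossed_cups b (\<not> b) s) \<Longrightarrow> rational_tangle u"
  using rational_tangle.crossed[of f g u b "\<not> b" s] by simp

lemma rational_tangle_nested_crossed:
  "fib_pair f g \<Longrightarrow> combination u f (nested_cups b b) g (crossed_cups b b s) \<Longrightarrow> rational_tangle u"
  using rational_tangle.crossed[of f g u b b s] by simp

lemmas rational_tangle_intros =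
  rational_tangle.parallel_nested rational_tangle_parallel_crossed rational_tangle_nested_crossed

text \<open>
  The over-strand \<open>s\<close> of the crossed basic tangle can be prescribed: changing it turns the
  coefficients $(f, g)$ into $(f + z g, g)$, which is again a Fibonacci pair.
\<close>

lemma rational_tangle_cases:
  assumes "rational_tangle u"
  obtains f g b where "fib_pair f g" "combination u f (parallel_cups b b) g (nested_cups b (\<not> b))"
  | f g b where "fib_pair f g" "combination u f (parallel_cups b (\<not> b)) g (crossed_cups b (\<not> b) s)"
  | f g b where "fib_pair f g" "combination u f (nested_cups b b) g (crossed_cups b b s)"
  using assms
proof cases
  case (crossed f g b c s')
  obtain f' where f': "fib_pair f' g"
    "combination u f' (if b = c then nested_cups b c else parallel_cups b c) g (crossed_cups b c s)"
  proof (cases "s' = s")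
    case True
    with crossed that show ?thesis by blast
  next
    case False
    then have "s = (\<not> s')" by blast
    with combination_crossing_change[OF crossed(2)] fib_pair_add[OF crossed(1)] that
    show ?thesis by blast
  qed
  show ?thesis
  proof (cases "b = c")
    case True
    with f' that(3)[of f' g b] show ?thesis by simp
  next
    case False
    then have "c = (\<not> b)" by blast
    with f' that(2)[of f' g b] show ?thesis by simp
  qed
qed (use that in blast)

lemma combination_single:
  assumes "u \<simeq> U" and "run U [] = run V []"
  shows "combination u 1 U 0 V"
  unfolding combination_def
  using assms nabla_tangle_isotopic[OF assms(1)] by (auto simp: tangle_isotopic_def)

lemma rational_tangle_parallel_cups:
  assumes "u \<simeq> parallel_cups b c"
  shows "rational_tangle u"
proof (cases "b = c")
  case True
  with assms have "combination u 1 (parallel_cups b b) 0 (nested_cups b (\<not> b))"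
    by (intro combination_single) auto
  then show ?thesis
    using rational_tangle_intros(1) fib_pair_swap[OF fib_pair_0_1] by blast
next
  case False
  then have "c = (\<not> b)" by blast
  with assms have "combination u 1 (parallel_cups b (\<not> b)) 0 (crossed_cups b (\<not> b) True)"
    by (intro combination_single) auto
  then show ?thesis
    using rational_tangle_intros(2) fib_pair_swap[OF fib_pair_0_1] by blast
qed

lemma rational_tangle_nested_cups:
  assumes "u \<simeq> nested_cups b c"
  shows "rational_tangle u"
proof (cases "b = c")
  case True
  with assms have "combination u 1 (nested_cups b b) 0 (crossed_cups b b True)"
    by (intro combination_single) auto
  then show ?thesis
    using rational_tangle_intros(3) fib_pair_swap[OF fib_pair_0_1] by blast
next
  case False
  then have "c = (\<not> b)" by blast
  with assms have "combination u 1 (nested_cups b (\<not> b)) 0 (parallel_cups b b)"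
    by (intro combination_single) auto
  then show ?thesis
    using rational_tangle_intros(1) combination_swap fib_pair_0_1 by blast
qed

lemma rational_tangle_length:
  assumes "rational_tangle u" and "run u [] = Some e"
  shows "length e = 4"
  using assms(1)
  by (cases rule: rational_tangle_cases[where s = True]) (use assms(2) in \<open>auto simp: combination_def\<close>)

text \<open>
  This is the heart of the argument. With the over-strand of the crossed basic tangle chosen so that
  the new crossing cancels it, every basic tangle is taken to a basic tangle up to isotopy, so the
  coefficients do not change except for their order. The nine cases are the three
  positions of the crossing and the three orientation patterns.
\<close>

lemma rational_tangle_Cross:
  assumes "rational_tangle u" and "Suc i < 4"
  shows "rational_tangle (u @ [Cross i s])"
proof -
  consider "i = 0" | "i = Suc 0" | "i = 2"
    using assms(2) by linarith
  then show ?thesis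
  proof cases
    assume i: "i = 0"
    from assms(1) show ?thesis
    proof (cases rule: rational_tangle_cases[where s = s])
      case (1 f g b)
      have "combination (u @ [Cross 0 s]) f (parallel_cups (\<not> b) b) g (crossed_cups (\<not> b) b (\<not> s))"
        by (intro combination_append[OF 1(2)] parallel_cups_Cross nested_cups_Cross)
      then show ?thesis
        using rational_tangle_intros(2)[of f g _ "\<not> b"] 1 i by simp
    next
      case (2 f g b)
      have "combination (u @ [Cross 0 s]) f (parallel_cups (\<not> b) (\<not> b)) g (nested_cups (\<not> b) b)"
        by (intro combination_append[OF 2(2)] parallel_cups_Cross crossed_cups_Cross)
      then show ?thesis
        using rational_tangle_intros(1)[of f g _ "\<not> b"] 2 i by simp
    next
      case (3 f g b)
      have "combination (u @ [Cross 0 s]) f (crossed_cups b b (\<not> s)) g (nested_cups b b)"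
        by (intro combination_append[OF 3(2)] nested_cups_Cross crossed_cups_Cross)
      from rational_tangle_intros(3)[OF fib_pair_swap[OF 3(1)] combination_swap[OF this]]
      show ?thesis unfolding i .
    qed
  next
    assume i: "i = Suc 0"
    from assms(1) show ?thesis
    \<comment> \<open>At the middle position Reidemeister move 2 needs opposite over-strands.\<close>
    proof (cases rule: rational_tangle_cases[where s = "\<not> s"])
      case (1 f g b)
      have "combination (u @ [Cross (Suc 0) s]) f (crossed_cups b b s) g (nested_cups b (\<not> \<not> b))"
        by (intro combination_append[OF 1(2)] parallel_cups_Cross nested_cups_Cross)
      from rational_tangle_intros(3)[OF fib_pair_swap[OF 1(1)] combination_swap[OF this, unfolded not_not]]
      show ?thesis unfolding i .
    next
      case (2 f g b)
      have "combination (u @ [Cross (Suc 0) s]) f (crossed_cups b (\<not> b) s) g (parallel_cups b (\<not> b))"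
        by (intro combination_append[OF 2(2)] parallel_cups_Cross crossed_cups_Cross)
      from rational_tangle_intros(2)[OF fib_pair_swap[OF 2(1)] combination_swap[OF this]]
      show ?thesis unfolding i .
    next
      case (3 f g b)
      have "combination (u @ [Cross (Suc 0) s]) f (nested_cups b (\<not> b)) g (parallel_cups b b)"
        by (intro combination_append[OF 3(2)] nested_cups_Cross crossed_cups_Cross)
      from rational_tangle_intros(1)[OF fib_pair_swap[OF 3(1)] combination_swap[OF this]]
      show ?thesis unfolding i .
    qed
  next
    assume i: "i = 2"
    from assms(1) show ?thesis
    proof (cases rule: rational_tangle_cases[where s = s])
      case (1 f g b)
      have "combination (u @ [Cross 2 s]) f (parallel_cups b (\<not> b)) g (crossed_cups b (\<not> b) (\<not> s))"
        by (intro combination_append[OF 1(2)] parallel_cups_Cross nested_cups_Cross)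
      from rational_tangle_intros(2)[OF 1(1) this] show ?thesis unfolding i .
    next
      case (2 f g b)
      have "combination (u @ [Cross 2 s]) f (parallel_cups b (\<not> \<not> b)) g (nested_cups b (\<not> b))"
        by (intro combination_append[OF 2(2)] parallel_cups_Cross crossed_cups_Cross)
      then have "combination (u @ [Cross 2 s]) f (parallel_cups b b) g (nested_cups b (\<not> b))"
        by simp
      from rational_tangle_intros(1)[OF 2(1) this] show ?thesis unfolding i .
    next
      case (3 f g b)
      have "combination (u @ [Cross 2 s]) f (crossed_cups b b (\<not> s)) g (nested_cups b b)"
        by (intro combination_append[OF 3(2)] nested_cups_Cross crossed_cups_Cross)
      from rational_tangle_intros(3)[OF fib_pair_swap[OF 3(1)] combination_swap[OF this]]
      show ?thesis unfolding i .
    qed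
  qed
qed

text \<open>
  After the first maximum of the diagram the tangle is equivalent to a multiple of a single arc.
\<close>

inductive arc_multiple :: "word \<Rightarrow> bool" where
  "run u [] = Some [b, \<not> b] \<Longrightarrow>
   (\<And>v. link_diagram (u @ v) \<Longrightarrow> nabla (u @ v) = fib_poly n * nabla (Cup 0 b # v)) \<Longrightarrow> arc_multiple u"

lemma arc_multiple_combination:
  assumes "combination u f U g V" and "fib_pair f g" and "U @ w \<simeq> [Cup 0 b]" and "null (V @ w)"
  shows "arc_multiple (u @ w)"
proof -
  obtain n where n: "f = fib_poly n"
    using assms(2) by (auto simp: fib_pair_def doubleton_eq_iff)
  note run = combination_run[OF assms(1)]
  show ?thesis
  proof (rule arc_multiple.intros)
    show "run (u @ w) [] = Some [b, \<not> b]"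
      using run assms(3) by (simp add: tangle_isotopic_def run_append)
    fix v
    assume v: "link_diagram ((u @ w) @ v)"
    then have "link_diagram ((U @ w) @ v)" "link_diagram ((V @ w) @ v)"
      using link_diagram_cong[OF run(1), of "w @ v"] link_diagram_cong[OF run(2), of "w @ v"]
      by auto
    then have "nabla (U @ w @ v) = nabla (Cup 0 b # v)" "nabla (V @ w @ v) = 0"
      using nabla_tangle_isotopic[OF assms(3)] assms(4) by (auto simp: null_def)
    moreover have "nabla (u @ w @ v) = f * nabla (U @ w @ v) + g * nabla (V @ w @ v)"
      using v assms(1) unfolding combination_def append_assoc by blast
    ultimately show "nabla ((u @ w) @ v) = fib_poly n * nabla (Cup 0 b # v)"
      by (simp add: n)
  qed
qed

lemma arc_multiple_null: "null u \<Longrightarrow> run u [] = Some [b, \<not> b] \<Longrightarrow> arc_multiple u"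
  by (rule arc_multiple.intros[where n = 0 and b = b]) (simp_all add: null_def)

text \<open>
  In each orientation pattern, every admissible maximum splits off a circle from one of the two basic
  tangles and joins the arcs of the other one, so exactly one of the coefficients survives.
\<close>

lemma rational_tangle_Cap:
  assumes "rational_tangle u" and "run (u @ [Cap i]) [] = Some e"
  shows "arc_multiple (u @ [Cap i])"
proof -
  obtain e' where e': "run u [] = Some e'" "act (Cap i) e' = Some e"
    using assms(2) by (auto simp: run_append bind_eq_Some_conv simp del: act.simps)
  have "Suc i < 4" and opp: "e' ! i \<noteq> e' ! Suc i"
    using rational_tangle_length[OF assms(1) e'(1)] e'(2) by (auto split: if_splits)
  then have i: "i = 0 \<or> i = Suc 0 \<or> i = 2"
    by linarith
  from assms(1) show ?thesis
  proof (cases rule: rational_tangle_cases[where s = True])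
    case (1 f g b)
    note first = arc_multiple_combination[OF 1(2,1)]
      and second = arc_multiple_combination[OF combination_swap[OF 1(2)] fib_pair_swap[OF 1(1)]]
    from i show ?thesis
      by (elim disjE) (use first[OF parallel_cups_Cap null_cups_Cap(1)] second[OF nested_cups_Cap(1) null_cups_Cap(3)]
        second[OF nested_cups_Cap(2) null_cups_Cap(2)] in simp_all)
  next
    case (2 f g b)
    then have "e' = [b, \<not> b, \<not> b, b]"
      using e' by (simp add: combination_def)
    then have "i \<noteq> Suc 0"
      using opp by auto
    note second = arc_multiple_combination[OF combination_swap[OF 2(2)] fib_pair_swap[OF 2(1)]]
    from i show ?thesis
      by (elim disjE) (use second[OF crossed_cups_Cap(2) null_cups_Cap(3)] \<open>i \<noteq> Suc 0\<close>
        second[OF crossed_cups_Cap(3) null_cups_Cap(2)] in simp_all)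
  next
    case (3 f g b)
    then have "e' = [b, b, \<not> b, \<not> b]"
      using e' by (simp add: combination_def)
    then have "i = Suc 0"
      using opp i by (elim disjE) (simp_all add: numeral_2_eq_2)
    then show ?thesis
      using arc_multiple_combination[OF combination_swap[OF 3(2)] fib_pair_swap[OF 3(1)]
          crossed_cups_Cap(1) null_cups_Cap(1)] by simp
  qed
qed

section \<open>Diagrams with two maxima\<close>

lemma Cup_Cross: "[Cup 0 b] @ [Cross 0 s] \<simeq> [Cup 0 (\<not> b)]"
  using tangle_isotopic_move[OF move.R1_cup[of 0 b s], of "[]" "[]"] by simp

lemma arc_multiple_Cross:
  assumes "arc_multiple u"
  shows "arc_multiple (u @ [Cross 0 s])"
  using assms
proof cases
  case (1 b n)
  show ?thesis
  proof (rule arc_multiple.intros)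
    show "run (u @ [Cross 0 s]) [] = Some [\<not> b, \<not> \<not> b]"
      using 1(1) by (simp add: run_append)
    fix v
    assume v: "link_diagram ((u @ [Cross 0 s]) @ v)"
    moreover from this have "link_diagram (([Cup 0 b] @ [Cross 0 s]) @ v)"
      using link_diagram_cong[of u "[Cup 0 b]" "[Cross 0 s] @ v"] 1(1) by simp
    ultimately show "nabla ((u @ [Cross 0 s]) @ v) = fib_poly n * nabla (Cup 0 (\<not> b) # v)"
      using 1(2)[of "[Cross 0 s] @ v"] nabla_tangle_isotopic[OF Cup_Cross, of b s v] by simp
  qed
qed

lemma arc_multiple_Cap:
  assumes "arc_multiple u"
  shows "\<exists>n. nabla (u @ [Cap 0]) = fib_poly n"
  using assms
proof cases
  case (1 b n)
  have "link_diagram (u @ [Cap 0])"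
    using 1(1) by (simp add: run_append link_diagram_def)
  then have "nabla (u @ [Cap 0]) = fib_poly n"
    using 1(2)[of "[Cap 0]"] nabla_unknot by simp
  then show ?thesis ..
qed

fun is_cup :: "slice \<Rightarrow> bool" where
  "is_cup (Cup i b) = True"
| "is_cup (Cap i) = False"
| "is_cup (Cross i s) = False"

definition num_minima :: "word \<Rightarrow> nat" where
  "num_minima D = length (filter is_cup D)"

lemma num_minima_append [simp]: "num_minima (u @ v) = num_minima u + num_minima v"
  by (simp add: num_minima_def)

lemma num_maxima_append [simp]: "num_maxima (u @ v) = num_maxima u + num_maxima v"
  by (simp add: num_maxima_def)

lemma num_minima_simps [simp]:
  "num_minima [] = 0" "num_minima [Cup i b] = 1" "num_minima [Cap i] = 0" "num_minima [Cross i s] = 0"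
  by (simp_all add: num_minima_def)

lemma num_maxima_simps [simp]:
  "num_maxima [] = 0" "num_maxima [Cup i b] = 0" "num_maxima [Cap i] = 1" "num_maxima [Cross i s] = 0"
  by (simp_all add: num_maxima_def)

lemma length_run: "run u [] = Some e \<Longrightarrow> length e + 2 * num_maxima u = 2 * num_minima u"
proof (induction u arbitrary: e rule: rev_induct)
  case (snoc x u)
  then obtain e' where "run u [] = Some e'" "act x e' = Some e"
    by (auto simp: run_append bind_eq_Some_conv)
  then show ?case
    using snoc.IH[of e'] by (cases x) (auto split: if_splits)
qed simp

text \<open>
  What is known about the part of a diagram below a level, given its numbers of minima and maxima.
  The rule \<open>circle\<close> is for diagrams whose first maximum precedes the second minimum;
  these split and their polynomial vanishes.
\<close>

inductive stage :: "word \<Rightarrow> nat \<Rightarrow> nat \<Rightarrow> bool" where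
  empty: "stage [] 0 0"
| arc: "u \<simeq> [Cup 0 b] \<Longrightarrow> stage u 1 0"
| circle: "u \<simeq> [Cup 0 b, Cap 0] \<Longrightarrow> stage u 1 1"
| rational: "rational_tangle u \<Longrightarrow> stage u 2 0"
| multiple: "arc_multiple u \<Longrightarrow> stage u 2 1"
| closed: "run u [] = Some [] \<Longrightarrow> nabla u = fib_poly n \<Longrightarrow> stage u 2 2"

lemma stage_snoc:
  assumes "stage u k l" and "run (u @ [x]) [] = Some e" and "k + num_minima [x] \<le> 2"
  shows "stage (u @ [x]) (k + num_minima [x]) (l + num_maxima [x])"
proof -
  obtain e' where e': "run u [] = Some e'" "act x e' = Some e"
    using assms(2) by (auto simp: run_append bind_eq_Some_conv)
  from assms(1) show ?thesis
  proof cases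
    case empty
    with e' obtain b where "x = Cup 0 b"
      by (cases x) (auto split: if_splits)
    then show ?thesis
      using empty stage.arc[of "[Cup 0 b]" b] by (simp add: tangle_isotopic_def isotopic_refl)
  next
    case (arc b)
    then have [simp]: "e' = [b, \<not> b]"
      using e' by (simp add: tangle_isotopic_def)
    have ext: "u @ [x] \<simeq> [Cup 0 b, x]"
      using tangle_isotopic_append[OF arc(3), of "[x]"] by simp
    show ?thesis
    proof (cases x)
      case (Cup i c)
      then have "i \<le> 2"
        using e' by (auto split: if_splits)
      then have "i = 0 \<or> i = Suc 0 \<or> i = 2"
        by linarith
      then have "rational_tangle (u @ [x])"
      proof (elim disjE)
        assume "i = 0"
        then have "u @ [x] \<simeq> parallel_cups c b"
          using tangle_isotopic_trans[OF ext] parallel_cups_commute Cup by blast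
        then show ?thesis by (rule rational_tangle_parallel_cups)
      next
        assume "i = Suc 0"
        then have "u @ [x] \<simeq> nested_cups b c"
          using ext Cup by (simp add: cups_defs)
        then show ?thesis by (rule rational_tangle_nested_cups)
      next
        assume "i = 2"
        then have "u @ [x] \<simeq> parallel_cups b c"
          using ext Cup by (simp add: cups_defs)
        then show ?thesis by (rule rational_tangle_parallel_cups)
      qed
      then show ?thesis
        using arc Cup stage.rational by (simp add: numeral_2_eq_2)
    next
      case (Cap i)
      then have "i = 0"
        using e' by (auto split: if_splits)
      then show ?thesis
        using stage.circle[of "u @ [x]" b] ext Cap arc by simp
    next
      case (Cross i s)
      then have "i = 0"
        using e' by (auto split: if_splits)
      then have "u @ [x] \<simeq> [Cup 0 (\<not> b)]"
        using tangle_isotopic_trans[OF ext] Cup_Cross Cross by simp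
      then show ?thesis
        using stage.arc[of "u @ [x]"] Cross arc by simp
    qed
  next
    case (circle b)
    then have [simp]: "e' = []"
      using e' by (simp add: tangle_isotopic_def)
    then obtain c where x: "x = Cup 0 c"
      using e' by (cases x) (auto split: if_splits)
    \<comment> \<open>A second minimum above a closed circle: the circle is split from the new arc, so the multiple is 0.\<close>
    have "u @ [x] \<simeq> [Cup 0 b, Cap 0, Cup 0 c]"
      using tangle_isotopic_append[OF circle(3), of "[x]"] x by simp
    also have "\<dots> \<simeq> parallel_cups b c @ [Cap 0]"
      using tangle_isotopic_move[OF move.exchange[of "Cap 0" "Cup 0 c"], of "[Cup 0 b]" "[]"]
      by (simp add: cups_defs)
    finally have "null (u @ [x])"
      using null_cups_Cap(3) null_tangle_isotopic by blast
    then have "arc_multiple (u @ [x])"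
      using arc_multiple_null[of _ c] e' x by (simp add: run_append)
    then show ?thesis
      using stage.multiple circle x by (simp add: numeral_2_eq_2)
  next
    case rational
    show ?thesis
    proof (cases x)
      case (Cap i)
      then show ?thesis
        using stage.multiple rational_tangle_Cap[of u i] assms(2) rational by simp
    next
      case (Cross i s)
      then have "Suc i < 4"
        using rational_tangle_length[OF rational(3) e'(1)] e'(2) by (auto split: if_splits)
      then show ?thesis
        using stage.rational rational_tangle_Cross rational Cross by simp
    qed (use rational assms(3) in simp)
  next
    case multiple
    from multiple(3) have len: "length e' = 2"
      by cases (use e' in simp)
    show ?thesis
    proof (cases x)
      case (Cap i)
      then have "i = 0"
        using e' len by (auto split: if_splits)
      moreover obtain n where "nabla (u @ [Cap 0]) = fib_poly n"
        using arc_multiple_Cap multiple by blast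
      moreover have "e = []"
        using e' Cap len \<open>i = 0\<close> by (auto split: if_splits)
      ultimately show ?thesis
        using stage.closed[of "u @ [Cap 0]"] assms(2) multiple Cap by (simp add: numeral_2_eq_2)
    next
      case (Cross i s)
      then have "i = 0"
        using e' len by (auto split: if_splits)
      then show ?thesis
        using stage.multiple arc_multiple_Cross multiple Cross by simp
    qed (use multiple assms(3) in simp)
  next
    case (closed n)
    then show ?thesis
      using e' assms(3) by (cases x) (auto split: if_splits)
  qed
qed

lemma stage_run:
  "run u [] = Some e \<Longrightarrow> num_minima u \<le> 2 \<Longrightarrow> stage u (num_minima u) (num_maxima u)"
proof (induction u arbitrary: e rule: rev_induct)
  case Nil
  show ?case by (simp add: stage.empty)
next
  case (snoc x u)
  then obtain e' where "run u [] = Some e'"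
    by (auto simp: run_append bind_eq_Some_conv)
  then show ?case
    using snoc.IH[of e'] stage_snoc[of u _ _ x e] snoc.prems by simp
qed

lemma nabla_two_bridge:
  assumes "two_bridge_link K"
  shows "\<exists>n. nabla K = fib_poly n"
proof -
  have "\<exists>k D. isotopic K D \<and> num_maxima D = k"
    using isotopic_refl by blast
  from LeastI_ex[OF this] obtain D where D: "isotopic K D" "num_maxima D = 2"
    using assms unfolding two_bridge_link_def bridge_number_def by auto
  have K: "link_diagram K"
    using assms by (simp add: two_bridge_link_def)
  then have run: "run D [] = Some []"
    using isotopic_link_diagram[OF D(1)] by (simp add: link_diagram_def)
  then have "num_minima D = 2"
    using length_run D(2) by fastforce
  then have "stage D 2 2"
    using stage_run[OF run] D(2) by simp
  then have "\<exists>n. nabla D = fib_poly n"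
    by cases auto
  then show ?thesis
    using nabla_isotopic[OF D(1) K] by simp
qed

end

section \<open>Coefficients of the Alexander polynomial\<close>

lemma of_int_bit_eq_0_iff: "(of_int k :: bit) = 0 \<longleftrightarrow> even k"
proof -
  have "of_int k = (of_int (k mod 2) :: bit)"
    by (metis mod_mult_div_eq of_int_add of_int_mult of_int_numeral bit_numeral_even mult_zero_left add.right_neutral)
  then show ?thesis
    by (cases "even k") (auto simp: even_iff_mod_2_eq_zero odd_iff_mod_2_eq_one)
qed

lemma map_poly_fib_poly: "map_poly of_int (fib_poly n :: int poly) = (fib_poly n :: 'a::comm_ring_1 poly)"
proof (induction n rule: fib_poly.induct)
  case (3 n)
  have "map_poly of_int ([:0, 1:] * p + q) = [:0, 1:] * map_poly of_int p + (map_poly of_int q :: 'a poly)" for p q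
    by (rule poly_eqI) (simp add: coeff_map_poly coeff_pCons split: nat.split)
  with 3 show ?case by simp
qed (simp_all add: map_poly_1)

lemma congruent_mod_two:
  assumes "map_poly of_int p = (map_poly of_int q :: bit poly)"
  obtains r :: "int poly" where "p = q + (r + r)"
proof
  show "p = q + (map_poly (\<lambda>c. c div 2) (p - q) + map_poly (\<lambda>c. c div 2) (p - q))"
  proof (rule poly_eqI)
    fix i
    have "(of_int (coeff (p - q) i) :: bit) = 0"
      using arg_cong[OF assms, of "\<lambda>p. coeff p i"] by (simp add: coeff_map_poly)
    then have "coeff (p - q) i div 2 + coeff (p - q) i div 2 = coeff (p - q) i"
      by (subst (asm) of_int_bit_eq_0_iff) presburger
    then show "coeff p i = coeff (q + (map_poly (\<lambda>c. c div 2) (p - q) + map_poly (\<lambda>c. c div 2) (p - q))) i"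
      by (simp only: coeff_add) (simp add: coeff_map_poly)
  qed
qed

lemma fls_nth_X_diff_times:
  "fls_nth ((fls_X - fls_X_inv) * f) m = fls_nth f (m - 1) - (fls_nth f (m + 1) :: 'a::comm_ring_1)"
  by (simp add: left_diff_distrib fls_X_times_conv_shift fls_X_inv_times_conv_shift)

lemma fls_nth_of_int_times: "fls_nth (of_int c * f) m = of_int c * fls_nth f m"
  by (simp add: fls_of_int)

text \<open>
  Modulo 2 the substitution is $z = x + x^{-1}$, for which the Fibonacci polynomials are the
  characters $x^n + x^{n-2} + \cdots + x^{-n}$ of Chebyshev type. The recursion says that
  the product of $x + x^{-1}$ with such a sum is the sum of the two neighbouring ones.
\<close>

lemma fib_poly_at_X_diff:
  "odd (fls_nth (poly (fib_poly (Suc n)) (fls_X - fls_X_inv :: int fls)) m) \<longleftrightarrow> \<bar>m\<bar> \<le> int n \<and> even (m - int n)"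
proof (induction n arbitrary: m rule: fib_poly.induct)
  case 1
  show ?case by auto
next
  case 2
  show ?case by (simp, presburger)
next
  case (3 n)
  define A B C where
    "A = fls_nth (poly (fib_poly (Suc (Suc n))) (fls_X - fls_X_inv :: int fls)) (m - 1)" and
    "B = fls_nth (poly (fib_poly (Suc (Suc n))) (fls_X - fls_X_inv :: int fls)) (m + 1)" and
    "C = fls_nth (poly (fib_poly (Suc n)) (fls_X - fls_X_inv :: int fls)) m"
  have coeff: "fls_nth (poly (fib_poly (Suc (Suc (Suc n)))) (fls_X - fls_X_inv :: int fls)) m = A - B + C"
    by (simp add: fls_nth_X_diff_times A_def B_def C_def del: fib_poly.simps
        add: fib_poly.simps(3)[of "Suc n"])
  have A: "odd A \<longleftrightarrow> \<bar>m - 1\<bar> \<le> int n + 1 \<and> even (m - 1 - (int n + 1))"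
    using 3(1)[of "m - 1"] unfolding A_def by (simp only: of_nat_Suc add.commute)
  have B: "odd B \<longleftrightarrow> \<bar>m + 1\<bar> \<le> int n + 1 \<and> even (m + 1 - (int n + 1))"
    using 3(1)[of "m + 1"] unfolding B_def by (simp only: of_nat_Suc add.commute)
  have C: "odd C \<longleftrightarrow> \<bar>m\<bar> \<le> int n \<and> even (m - int n)"
    using 3(2)[of m] unfolding C_def .
  \<comment> \<open>The supports of the two shifts, and of the sum two steps back, overlap so that only the support of the new sum remains.\<close>
  have support: "((\<bar>m - 1\<bar> \<le> l + 1 \<and> even (m - 1 - (l + 1))) \<noteq>
      (\<bar>m + 1\<bar> \<le> l + 1 \<and> even (m + 1 - (l + 1)))) \<noteq> (\<bar>m\<bar> \<le> l \<and> even (m - l))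
    \<longleftrightarrow> \<bar>m\<bar> \<le> l + 2 \<and> even (m - (l + 2))" if "l \<ge> 0" for l
  proof -
    have "even (m - 1 - (l + 1)) \<longleftrightarrow> even (m - l)" "even (m + 1 - (l + 1)) \<longleftrightarrow> even (m - l)"
      "even (m - (l + 2)) \<longleftrightarrow> even (m - l)"
      by presburger+
    moreover have "((\<bar>m - 1\<bar> \<le> l + 1) \<noteq> (\<bar>m + 1\<bar> \<le> l + 1)) \<noteq> (\<bar>m\<bar> \<le> l) \<longleftrightarrow> \<bar>m\<bar> \<le> l + 2"
      unfolding abs_le_iff using that by arith
    ultimately show ?thesis by blast
  qed
  have "odd (A - B + C) \<longleftrightarrow> (odd A \<noteq> odd B) \<noteq> odd C"
    by auto
  also have "\<dots> \<longleftrightarrow> \<bar>m\<bar> \<le> int n + 2 \<and> even (m - (int n + 2))"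
    unfolding A B C by (rule support) simp
  finally show ?case
    unfolding coeff by (simp add: add.commute)
qed

theorem corollary5p5:
  fixes conway :: "word \<Rightarrow> int poly" and K :: word and \<Delta> :: "int fls"
    and n :: nat and a :: "nat \<Rightarrow> int"
  assumes "conway_polynomial conway"
    and "two_bridge_link K" and "num_components K = 2"
    and "is_alexander_polynomial conway K \<Delta>"
    and "\<Delta> = (fls_X - fls_X_inv) *
           (of_int (a 0) +
            (\<Sum>i=1..n. of_int ((-1) ^ i * a i) * (fls_X ^ (2 * i) + fls_X_inv ^ (2 * i))))"
  shows "(\<forall>i\<le>n. even (a i)) \<or>
         (\<exists>k\<le>n. \<forall>i\<le>n. odd (a i) \<longleftrightarrow> i \<le> k \<and> even (k - i))"
proof -
  interpret conway_mod_two conway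
    using assms(1) by unfold_locales
  obtain N where N: "map_poly of_int (conway K) = (fib_poly N :: bit poly)"
    using nabla_two_bridge[OF assms(2)] by (auto simp: nabla_def)
  then obtain r where r: "conway K = fib_poly N + (r + r)"
    using congruent_mod_two map_poly_fib_poly by metis
  define y :: "int fls" where "y = fls_X - fls_X_inv"
  define P where "P = of_int (a 0) + (\<Sum>i=1..n. of_int ((-1) ^ i * a i) * (fls_X ^ (2 * i) + fls_X_inv ^ (2 * i)) :: int fls)"
  have map_add: "map_poly of_int (p + q) = map_poly of_int p + (map_poly of_int q :: int fls poly)" for p q
    by (rule poly_eqI) (simp add: coeff_map_poly)
  obtain \<epsilon> :: "int fls" where \<epsilon>: "\<epsilon> \<in> {1, -1}" "\<Delta> = \<epsilon> * poly (map_poly of_int (conway K)) y"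
    using assms(4) unfolding is_alexander_polynomial_def y_def by blast
  have "poly (map_poly of_int (conway K)) y =
      poly (fib_poly N) y + (poly (map_poly of_int r) y + poly (map_poly of_int r) y)"
    by (simp only: r map_add map_poly_fib_poly poly_add)
  then have "fls_nth (poly (map_poly of_int (conway K)) y) m =
      fls_nth (poly (fib_poly N) y) m + 2 * fls_nth (poly (map_poly of_int r) y) m" for m
    by (simp only: fls_plus_nth mult_2)
  with \<epsilon> have parity: "odd (fls_nth \<Delta> m) \<longleftrightarrow> odd (fls_nth (poly (fib_poly N) y) m)" for m
    by auto
  have coeff_P: "fls_nth P (2 * int i) = (if i \<le> n then (-1) ^ i * a i else 0)" for i
  proof -
    have "fls_nth P (2 * int i) = (if i = 0 then a 0 else 0) +
        (\<Sum>j=1..n. if j = i then (-1) ^ j * a j else 0)"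
      unfolding P_def fls_plus_nth fls_nth_sum fls_of_int_nth fls_nth_of_int_times
      by (intro arg_cong2[where f = "(+)"] sum.cong) auto
    then show ?thesis by (cases "i = 0") auto
  qed
  have coeff_P_odd: "fls_nth P m = 0" if "odd m" for m
    using that by (auto simp: P_def fls_nth_sum fls_of_int_nth fls_nth_of_int_times simp del: of_int_mult of_int_power intro!: sum.neutral)
  have \<Delta>: "fls_nth \<Delta> m = fls_nth P (m - 1) - fls_nth P (m + 1)" for m
    using assms(5) by (simp add: P_def fls_nth_X_diff_times)
  \<comment> \<open>Extending the coefficients by 0 makes the relation between neighbours valid also at the end.\<close>
  define b where "b i = (if i \<le> n then a i else 0)" for i
  have b: "even (fls_nth \<Delta> (2 * int i + 1)) \<longleftrightarrow> even (b i + b (Suc i))" for i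
    using \<Delta>[of "2 * int i + 1"] coeff_P[of i] coeff_P[of "Suc i"] by (auto simp: b_def)
  show ?thesis
  proof (cases N)
    case 0
    have step: "even (b i) \<longleftrightarrow> even (b (Suc i))" for i
      using b[of i] parity[of "2 * int i + 1"] 0 by simp
    have "even (b i) \<longleftrightarrow> even (b (i + j))" for i j
      by (induction j) (use step in auto)
    from this[of _ "Suc n"] have "even (b i)" for i
      by (simp add: b_def)
    then show ?thesis by (metis b_def)
  next
    case (Suc M)
    have supp: "odd (fls_nth \<Delta> m) \<longleftrightarrow> \<bar>m\<bar> \<le> int M \<and> even (m - int M)" for m
      using parity[of m] fib_poly_at_X_diff[of M m] by (simp add: Suc y_def)
    \<comment> \<open>An even \<open>M\<close> would put an odd coefficient at an even exponent of \<open>\<Delta>\<close>.\<close>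
    have "odd M"
    proof
      assume "even M"
      then have "fls_nth \<Delta> (int M) = 0"
        using \<Delta>[of "int M"] coeff_P_odd by simp
      with supp[of "int M"] show False by simp
    qed
    then obtain k where k: "M = 2 * k + 1" by (elim oddE)
    have step: "odd (b i + b (Suc i)) \<longleftrightarrow> i \<le> k" for i
      using b[of i] supp[of "2 * int i + 1"] k by auto
    have above: "even (b i)" if "i > k" for i
    proof -
      have "even (b i) \<longleftrightarrow> even (b (i + j))" for j
      proof (induction j)
        case (Suc j)
        then show ?case using step[of "i + j"] that by simp
      qed simp
      from this[of "Suc n"] show ?thesis by (simp add: b_def)
    qed
    have below: "odd (b (k - j)) \<longleftrightarrow> even j" if "j \<le> k" for j
      using that
    proof (induction j)
      case 0
      show ?case using step[of k] above[of "Suc k"] by simp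
    next
      case (Suc j)
      then show ?case using step[of "k - Suc j"] by (simp add: Suc_diff_Suc)
    qed
    have odd_b: "odd (b i) \<longleftrightarrow> i \<le> k \<and> even (k - i)" for i
      using above[of i] below[of "k - i"] by (cases "i \<le> k") auto
    have "k \<le> n"
      using odd_b[of k] by (auto simp: b_def split: if_splits)
    moreover have "odd (a i) \<longleftrightarrow> i \<le> k \<and> even (k - i)" if "i \<le> n" for i
      using odd_b[of i] that by (simp add: b_def)
    ultimately show ?thesis by blast
  qed
qed

end
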